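(* Let $\mathfrak g$ be a Leibniz algebra. Then the naive cohomology of $\mathfrak g$ for the adjoint naive representation $\mathfrak{ad}=\mathrm{ad}_L+\mathrm{id}:\mathfrak g\to\mathfrak{gl}(\mathfrak g)\oplus\mathfrak g$ agrees with (is isomorphic to) the Leibniz cohomology of $\mathfrak g$ with coefficients in the adjoint representation $(\mathfrak g,\mathrm{ad}_L,\mathrm{ad}_R)$: $$H^\bullet_{naive}(\mathfrak g;\mathfrak{ad})=H^\bullet(\mathfrak g;\mathrm{ad}_L,\mathrm{ad}_R).$$
   Context: All vector spaces are over $\mathbb R$. A Leibniz algebra is a vector space $\mathfrak g$ with a linear map $[\cdot,\cdot]_{\mathfrak g}:\mathfrak g\otimes\mathfrak g\to\mathfrak g$ satisfying $[x,[y,z]_{\mathfrak g}]_{\mathfrak g}=[[x,y]_{\mathfrak g},z]_{\mathfrak g}+[y,[x,z]_{\mathfrak g}]_{\mathfrak g}$. Representation and Leibniz cohomology: a representation $(V,l,r)$ of $\mathfrak g$ is a vector space $V$ with linear maps $l,r:\mathfrak g\to\mathfrak{gl}(V)$ such that $l_{[x,y]_{\mathfrak g}}=[l_x,l_y]$, $r_{[x,y]_{\mathfrak g}}=[l_x,r_y]$, $r_y\circ l_x=-r_y\circ r_x$. Its cohomology $H^\bullet(\mathfrak g;l,r)$ is that of the complex $C^k(\mathfrak g,V)=\mathrm{Hom}(\otimes^k\mathfrak g,V)$, $k\ge0$, with $$\partial c(x_1,\dots,x_{k+1})=\sum_{i=1}^k(-1)^{i+1}l_{x_i}c(x_1,\dots,\widehat{x_i},\dots,x_{k+1})+(-1)^{k+1}r_{x_{k+1}}c(x_1,\dots,x_k)+\sum_{1\le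 i<j\le k+1}(-1)^ic(x_1,\dots,\widehat{x_i},\dots,x_{j-1},[x_i,x_j]_{\mathfrak g},x_{j+1},\dots,x_{k+1}).$$ The adjoint representation is $(\mathfrak g,\mathrm{ad}_L,\mathrm{ad}_R)$ with $\mathrm{ad}_L(x)(y)=[x,y]_{\mathfrak g}$ and $\mathrm{ad}_R(x)(y)=[y,x]_{\mathfrak g}$. Naive representation and naive cohomology: the omni-Lie algebra $\mathfrak{ol}(V)$ is $\mathfrak{gl}(V)\oplus V$ with the Leibniz bracket $\{A+u,B+v\}=[A,B]+Av$. A naive representation of $\mathfrak g$ on $V$ is a Leibniz algebra homomorphism $\rho:\mathfrak g\to\mathfrak{ol}(V)$. Its naive cohomology $H^\bullet_{naive}(\mathfrak g;\rho)$ is the cohomology of $C^k(\mathfrak g;\rho)=\{\text{linear maps }f:\otimes^k\mathfrak g\to\mathrm{im}(\rho)\}$ with the differential $$\delta c(x_1,\dots,x_{k+1})=\sum_{i=1}^k(-1)^{i+1}\{\rho(x_i),c(x_1,\dots,\widehat{x_i},\dots,x_{k+1})\}+(-1)^{k+1}\{c(x_1,\dots,x_k),\rho(x_{k+1})\}+\sum_{1\le i<j\le k+1}(-1)^ic(x_1,\dots,\widehat{x_i},\dots,x_{j-1},[x_i,x_j]_{\mathfrak g},x_{j+1},\dots,x_{k+1}).$$ The adjoint naive representation $\mathfrak{ad}:\mathfrak g\to\mathfrak{ol}(\mathfrak g)$ is $\mathfrak{ad}(x)=\mathrm{ad}_L(x)+x$. *)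

theory Defs
  imports "HOL-Analysis.Analysis" "HOL-Library.Function_Algebras"
begin

instantiation "fun" :: (type, real_vector) real_vector
begin

definition scaleR_fun :: "real \<Rightarrow> ('a \<Rightarrow> 'b) \<Rightarrow> 'a \<Rightarrow> 'b" where
  "scaleR_fun r f = (\<lambda>x. r *\<^sub>R f x)"

instance
  by standard (simp_all add: scaleR_fun_def fun_eq_iff algebra_simps)

end

lemma scaleR_fun_apply [simp]: "(r *\<^sub>R f) x = r *\<^sub>R f x"
  by (simp add: scaleR_fun_def)

record 'a vspace =
  vs_carrier :: "'a set"
  vs_add :: "'a \<Rightarrow> 'a \<Rightarrow> 'a"
  vs_scale :: "real \<Rightarrow> 'a \<Rightarrow> 'a"

definition vs_iso :: "'a vspace \<Rightarrow> 'b vspace \<Rightarrow> bool" (infix "\<cong>\<^sub>v" 50) where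
  "V \<cong>\<^sub>v W \<longleftrightarrow> (\<exists>\<phi>. bij_betw \<phi> (vs_carrier V) (vs_carrier W)
     \<and> (\<forall>X\<in>vs_carrier V. \<forall>Y\<in>vs_carrier V. \<phi> (vs_add V X Y) = vs_add W (\<phi> X) (\<phi> Y))
     \<and> (\<forall>t. \<forall>X\<in>vs_carrier V. \<phi> (vs_scale V t X) = vs_scale W t (\<phi> X)))"

definition coset :: "'a::real_vector set \<Rightarrow> 'a \<Rightarrow> 'a set" where
  "coset B z = {z + b | b. b \<in> B}"

text \<open>Adding \<open>B\<close> in the scalar multiplication only matters for the scalar \<open>0\<close>,
  where the setwise multiple of a coset would be \<open>{0}\<close> instead of \<open>B\<close>.\<close>

definition quotient_space :: "'a::real_vector set \<Rightarrow> 'a set \<Rightarrow> 'a set vspace" where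
  "quotient_space Z B =
     \<lparr>vs_carrier = coset B ` Z,
      vs_add = (\<lambda>X Y. {x + y | x y. x \<in> X \<and> y \<in> Y}),
      vs_scale = (\<lambda>t X. {t *\<^sub>R x + b | x b. x \<in> X \<and> b \<in> B})\<rparr>"

lemma quotient_space_add:
  assumes "subspace B"
  shows "vs_add (quotient_space Z B) (coset B x) (coset B y) = coset B (x + y)"
proof (intro equalityI subsetI)
  fix u assume "u \<in> vs_add (quotient_space Z B) (coset B x) (coset B y)"
  then obtain b1 b2 where "b1 \<in> B" "b2 \<in> B" "u = (x + b1) + (y + b2)"
    by (auto simp: quotient_space_def coset_def)
  then have "u = (x + y) + (b1 + b2)" "b1 + b2 \<in> B"
    using assms by (simp_all add: subspace_add algebra_simps)
  then show "u \<in> coset B (x + y)" unfolding coset_def by blast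
next
  fix u assume "u \<in> coset B (x + y)"
  then obtain b where "b \<in> B" "u = (x + 0) + (y + b)"
    by (auto simp: coset_def algebra_simps)
  then show "u \<in> vs_add (quotient_space Z B) (coset B x) (coset B y)"
    using subspace_0[OF assms] unfolding quotient_space_def coset_def vspace.simps by blast
qed

lemma quotient_space_scale:
  assumes "subspace B"
  shows "vs_scale (quotient_space Z B) t (coset B x) = coset B (t *\<^sub>R x)"
proof (intro equalityI subsetI)
  fix u assume "u \<in> vs_scale (quotient_space Z B) t (coset B x)"
  then obtain b1 b2 where "b1 \<in> B" "b2 \<in> B" "u = t *\<^sub>R (x + b1) + b2"
    by (auto simp: quotient_space_def coset_def)
  then have "u = t *\<^sub>R x + (t *\<^sub>R b1 + b2)" "t *\<^sub>R b1 + b2 \<in> B"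
    using assms by (simp_all add: subspace_add subspace_scale algebra_simps)
  then show "u \<in> coset B (t *\<^sub>R x)" unfolding coset_def by blast
next
  fix u assume "u \<in> coset B (t *\<^sub>R x)"
  then obtain b where "b \<in> B" "u = t *\<^sub>R (x + 0) + b"
    by (auto simp: coset_def)
  then show "u \<in> vs_scale (quotient_space Z B) t (coset B x)"
    using subspace_0[OF assms] unfolding quotient_space_def coset_def vspace.simps by blast
qed

locale leibniz_algebra =
  fixes br :: "'g::real_vector \<Rightarrow> 'g \<Rightarrow> 'g"
  assumes bilinear_br: "bilinear br"
    and leibniz: "br x (br y z) = br (br x y) z + br y (br x z)"

typedef (overloaded) 'v gl = "{A :: 'v::real_vector \<Rightarrow> 'v. linear A}"
  morphisms gl_app Abs_gl
  by (rule exI[of _ "\<lambda>x. 0"]) (simp add: linear_iff)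

setup_lifting type_definition_gl

instantiation gl :: (real_vector) real_vector
begin

lift_definition zero_gl :: "'a gl" is "\<lambda>v. 0" by (simp add: linear_iff)
lift_definition plus_gl :: "'a gl \<Rightarrow> 'a gl \<Rightarrow> 'a gl" is "\<lambda>A B v. A v + B v"
  by (simp add: linear_iff algebra_simps)
lift_definition minus_gl :: "'a gl \<Rightarrow> 'a gl \<Rightarrow> 'a gl" is "\<lambda>A B v. A v - B v"
  by (simp add: linear_iff algebra_simps)
lift_definition uminus_gl :: "'a gl \<Rightarrow> 'a gl" is "\<lambda>A v. - A v"
  by (simp add: linear_iff)
lift_definition scaleR_gl :: "real \<Rightarrow> 'a gl \<Rightarrow> 'a gl" is "\<lambda>t A v. t *\<^sub>R A v"
  by (simp add: linear_iff algebra_simps)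

instance
  by standard (transfer; simp add: fun_eq_iff algebra_simps)+

end

lift_definition gl_comp :: "'v::real_vector gl \<Rightarrow> 'v gl \<Rightarrow> 'v gl" is "\<lambda>A B. A \<circ> B"
  by (simp add: linear_compose)

definition gl_comm :: "'v::real_vector gl \<Rightarrow> 'v gl \<Rightarrow> 'v gl" where
  "gl_comm A B = gl_comp A B - gl_comp B A"

text \<open>The omni-Lie algebra \<open>gl(V) \<oplus> V\<close>, with \<open>A + u\<close> encoded as the pair \<open>(A, u)\<close>
  and bracket \<open>{A + u, B + v} = [A, B] + A v\<close>.\<close>

definition ol_br :: "'v::real_vector gl \<times> 'v \<Rightarrow> 'v gl \<times> 'v \<Rightarrow> 'v gl \<times> 'v" where
  "ol_br e f = (gl_comm (fst e) (fst f), gl_app (fst e) (snd f))"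

lemma linear_gl_app: "linear (gl_app A)"
  using gl_app by blast

lemma gl_app_simps [simp]:
  "gl_app (A + B) v = gl_app A v + gl_app B v"
  "gl_app (A - B) v = gl_app A v - gl_app B v"
  "gl_app (t *\<^sub>R A) v = t *\<^sub>R gl_app A v"
  "gl_app (gl_comp A B) v = gl_app A (gl_app B v)"
  by (transfer; simp)+

lemma gl_eqI: "(\<And>v. gl_app A v = gl_app B v) \<Longrightarrow> A = B"
  by (metis ext gl_app_inject)

lemma leibniz_algebra_ol: "leibniz_algebra (ol_br :: 'v::real_vector gl \<times> 'v \<Rightarrow> _)"
  by standard
    (auto simp: bilinear_def linear_iff ol_br_def gl_comm_def
       linear_add[OF linear_gl_app] linear_scale[OF linear_gl_app] linear_diff[OF linear_gl_app]
       algebra_simps intro!: gl_eqI)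

definition leibniz_rep ::
  "('g::real_vector \<Rightarrow> 'g \<Rightarrow> 'g) \<Rightarrow> ('g \<Rightarrow> 'v::real_vector gl) \<Rightarrow> ('g \<Rightarrow> 'v gl) \<Rightarrow> bool" where
  "leibniz_rep br l r \<longleftrightarrow> linear l \<and> linear r \<and>
     (\<forall>x y. l (br x y) = gl_comm (l x) (l y)) \<and>
     (\<forall>x y. r (br x y) = gl_comm (l x) (r y)) \<and>
     (\<forall>x y. gl_comp (r y) (l x) = - gl_comp (r y) (r x))"

definition naive_rep ::
  "('g::real_vector \<Rightarrow> 'g \<Rightarrow> 'g) \<Rightarrow> ('g \<Rightarrow> 'v::real_vector gl \<times> 'v) \<Rightarrow> bool" where
  "naive_rep br \<rho> \<longleftrightarrow> linear \<rho> \<and> (\<forall>x y. \<rho> (br x y) = ol_br (\<rho> x) (\<rho> y))"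

text \<open>The arguments of \<open>Abs_gl\<close> are linear maps as soon as \<open>br\<close> is bilinear.\<close>

definition ad_L :: "('g::real_vector \<Rightarrow> 'g \<Rightarrow> 'g) \<Rightarrow> 'g \<Rightarrow> 'g gl" where
  "ad_L br x = Abs_gl (\<lambda>y. br x y)"

definition ad_R :: "('g::real_vector \<Rightarrow> 'g \<Rightarrow> 'g) \<Rightarrow> 'g \<Rightarrow> 'g gl" where
  "ad_R br x = Abs_gl (\<lambda>y. br y x)"

definition naive_ad :: "('g::real_vector \<Rightarrow> 'g \<Rightarrow> 'g) \<Rightarrow> 'g \<Rightarrow> 'g gl \<times> 'g" where
  "naive_ad br x = (ad_L br x, x)"

context leibniz_algebra
begin

lemma gl_app_ad [simp]:
  "gl_app (ad_L br x) y = br x y"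
  "gl_app (ad_R br x) y = br y x"
  using bilinear_br by (simp_all add: ad_L_def ad_R_def Abs_gl_inverse bilinear_def)

lemma leibniz_rep_ad: "leibniz_rep br (ad_L br) (ad_R br)"
proof -
  note bil = bilinear_ladd[OF bilinear_br] bilinear_radd[OF bilinear_br]
    bilinear_lmul[OF bilinear_br] bilinear_rmul[OF bilinear_br]
  have l: "br (br x y) v = br x (br y v) - br y (br x v)" for x y v
    using leibniz[of x y v] by simp
  have r: "br v (br x y) = br x (br v y) - br (br x v) y" for x y v
    using leibniz[of x v y] by simp
  have lr: "br (br x v) y = - br (br v x) y" for x v y
    unfolding l by simp
  have neg: "gl_app (- A) v = - gl_app A v" for A :: "'g gl" and v
    by transfer simp
  have "linear (ad_L br)" "linear (ad_R br)"
    by (auto simp: linear_iff bil intro!: gl_eqI)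
  moreover have "ad_L br (br x y) = gl_comm (ad_L br x) (ad_L br y)" for x y
    using l by (intro gl_eqI) (simp add: gl_comm_def)
  moreover have "ad_R br (br x y) = gl_comm (ad_L br x) (ad_R br y)" for x y
    by (intro gl_eqI) (simp add: gl_comm_def r[symmetric])
  moreover have "gl_comp (ad_R br y) (ad_L br x) = - gl_comp (ad_R br y) (ad_R br x)" for x y
    by (intro gl_eqI) (simp add: neg lr[of x])
  ultimately show ?thesis
    unfolding leibniz_rep_def by blast
qed

lemma naive_rep_ad: "naive_rep br (naive_ad br)"
  using leibniz_rep_ad
  by (auto simp: naive_rep_def leibniz_rep_def naive_ad_def ol_br_def linear_iff)

end

text \<open>A linear map \<open>\<otimes>\<^sup>k \<gg> \<rightarrow> W\<close> is encoded by the corresponding \<open>k\<close>-linear map, a function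
  on lists of length \<open>k\<close>, set to zero on lists of any other length so that equality of
  cochains is equality of functions. For \<open>k = 0\<close> this is an arbitrary element of \<open>W\<close>, the
  value at the empty list.\<close>

definition cochains :: "'v::real_vector set \<Rightarrow> nat \<Rightarrow> ('g::real_vector list \<Rightarrow> 'v) set" where
  "cochains W k = {c.
     (\<forall>xs. length xs = k \<longrightarrow> c xs \<in> W) \<and>
     (\<forall>xs. length xs \<noteq> k \<longrightarrow> c xs = 0) \<and>
     (\<forall>xs i. length xs = k \<longrightarrow> i < k \<longrightarrow> linear (\<lambda>x. c (xs[i := x])))}"

definition omit :: "nat \<Rightarrow> 'a list \<Rightarrow> 'a list" where
  "omit i xs = take i xs @ drop (Suc i) xs"

text \<open>The Leibniz differential in degree \<open>k\<close>, for a left action \<open>L\<close> and a right action \<open>R\<close>.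
  List positions start at \<open>0\<close>, so \<open>x\<^sub>i\<close> is \<open>xs ! (i - 1)\<close> and the signs \<open>(-1)\<^sup>i\<^sup>+\<^sup>1\<close> and \<open>(-1)\<^sup>i\<close>
  of the usual formula, with \<open>i\<close> starting at \<open>1\<close>, become \<open>(-1)\<^sup>i\<close> and \<open>(-1)\<^sup>i\<^sup>+\<^sup>1\<close>.\<close>

definition diff ::
  "('g::real_vector \<Rightarrow> 'g \<Rightarrow> 'g) \<Rightarrow> ('g \<Rightarrow> 'v::real_vector \<Rightarrow> 'v) \<Rightarrow> ('g \<Rightarrow> 'v \<Rightarrow> 'v)
   \<Rightarrow> nat \<Rightarrow> ('g list \<Rightarrow> 'v) \<Rightarrow> 'g list \<Rightarrow> 'v" where
  "diff br L R k c = (\<lambda>xs. if length xs \<noteq> Suc k then 0 else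
     (\<Sum>i<k. (-1) ^ i *\<^sub>R L (xs ! i) (c (omit i xs)))
     + (-1) ^ (k + 1) *\<^sub>R R (xs ! k) (c (take k xs))
     + (\<Sum>j\<le>k. \<Sum>i<j. (-1) ^ (i + 1) *\<^sub>R c (omit i (xs[j := br (xs ! i) (xs ! j)]))))"

definition cohomology ::
  "(nat \<Rightarrow> 'c::real_vector set) \<Rightarrow> (nat \<Rightarrow> 'c \<Rightarrow> 'c) \<Rightarrow> nat \<Rightarrow> 'c set vspace" where
  "cohomology C d k = quotient_space
     {c \<in> C k. d k c = 0}
     (case k of 0 \<Rightarrow> {0} | Suc m \<Rightarrow> d m ` C m)"

definition leibniz_diff ::
  "('g::real_vector \<Rightarrow> 'g \<Rightarrow> 'g) \<Rightarrow> ('g \<Rightarrow> 'v::real_vector gl) \<Rightarrow> ('g \<Rightarrow> 'v gl)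
   \<Rightarrow> nat \<Rightarrow> ('g list \<Rightarrow> 'v) \<Rightarrow> 'g list \<Rightarrow> 'v" where
  "leibniz_diff br l r = diff br (\<lambda>x v. gl_app (l x) v) (\<lambda>x v. gl_app (r x) v)"

definition leibniz_cohomology ::
  "('g::real_vector \<Rightarrow> 'g \<Rightarrow> 'g) \<Rightarrow> ('g \<Rightarrow> 'v::real_vector gl) \<Rightarrow> ('g \<Rightarrow> 'v gl)
   \<Rightarrow> nat \<Rightarrow> ('g list \<Rightarrow> 'v) set vspace" where
  "leibniz_cohomology br l r = cohomology (cochains UNIV) (leibniz_diff br l r)"

definition naive_diff ::
  "('g::real_vector \<Rightarrow> 'g \<Rightarrow> 'g) \<Rightarrow> ('g \<Rightarrow> 'v::real_vector gl \<times> 'v)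
   \<Rightarrow> nat \<Rightarrow> ('g list \<Rightarrow> 'v gl \<times> 'v) \<Rightarrow> 'g list \<Rightarrow> 'v gl \<times> 'v" where
  "naive_diff br \<rho> = diff br (\<lambda>x e. ol_br (\<rho> x) e) (\<lambda>x e. ol_br e (\<rho> x))"

definition naive_cohomology ::
  "('g::real_vector \<Rightarrow> 'g \<Rightarrow> 'g) \<Rightarrow> ('g \<Rightarrow> 'v::real_vector gl \<times> 'v)
   \<Rightarrow> nat \<Rightarrow> ('g list \<Rightarrow> 'v gl \<times> 'v) set vspace" where
  "naive_cohomology br \<rho> = cohomology (cochains (range \<rho>)) (naive_diff br \<rho>)"

end

theory Submission
  imports Defs
begin

text \<open>The adjoint naive representation \<open>\<rho> = naive_ad br\<close> is linear, and injective because its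
  second component is the identity. It therefore identifies the vector space \<open>\<gg>\<close> with
  \<open>im \<rho>\<close>, so postcomposition with \<open>\<rho>\<close> is a linear bijection from the cochains with values
  in \<open>\<gg>\<close> to the naive cochains, which take values in \<open>im \<rho>\<close> (\<open>image_comp_cochains\<close>).

  Because \<open>\<rho>\<close> is a homomorphism of Leibniz algebras,
  \<open>\<rho> (ad\<^sub>L(x) v) = \<rho> [x, v] = {\<rho> x, \<rho> v}\<close> and \<open>\<rho> (ad\<^sub>R(x) v) = \<rho> [v, x] = {\<rho> v, \<rho> x}\<close>,
  so \<open>\<rho>\<close> intertwines the left and right actions that occur in the two differentials.
  The bijection thus commutes with the differentials (\<open>comp_diff\<close>), and an isomorphism of
  complexes induces an isomorphism in cohomology (\<open>cohomology_iso\<close>).\<close>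

text \<open>The isomorphism is \<open>vimage F\<close>, the inverse of the map that \<open>F\<close> induces on cosets.
  For an injective \<open>F\<close>, images and preimages are mutually inverse bijections between the subsets
  of the domain and the subsets of the range of \<open>F\<close>; and \<open>F\<close> carries the
  cosets of \<open>B\<close>, with their setwise operations, to those of \<open>F ` B\<close> because it is linear.\<close>

lemma quotient_space_image_iso:
  assumes "linear F" and "inj F"
  shows "quotient_space (F ` Z) (F ` B) \<cong>\<^sub>v quotient_space Z B"
proof -
  have vimage_image: "F -` F ` X = X" for X
    using assms(2) by (rule inj_vimage_image_eq)
  have coset: "coset (F ` B) (F z) = F ` coset B z" for z
  proof -
    have "coset (F ` B) (F z) = {F (z + b) | b. b \<in> B}"
      unfolding coset_def linear_add[OF assms(1)] by blast
    then show ?thesis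
      unfolding coset_def by blast
  qed
  have carrier: "vs_carrier (quotient_space (F ` Z) (F ` B))
      = (`) F ` vs_carrier (quotient_space Z B)"
    by (simp add: quotient_space_def image_image coset)
  have add: "vs_add (quotient_space (F ` Z) (F ` B)) (F ` X) (F ` Y)
      = F ` vs_add (quotient_space Z B) X Y" for X Y
  proof -
    have "{x + y | x y. x \<in> F ` X \<and> y \<in> F ` Y} = {F (x + y) | x y. x \<in> X \<and> y \<in> Y}"
      unfolding linear_add[OF assms(1)] by blast
    then show ?thesis
      unfolding quotient_space_def vspace.simps by blast
  qed
  have scale: "vs_scale (quotient_space (F ` Z) (F ` B)) t (F ` X)
      = F ` vs_scale (quotient_space Z B) t X" for t X
  proof -
    have "{t *\<^sub>R x + b | x b. x \<in> F ` X \<and> b \<in> F ` B}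
        = {F (t *\<^sub>R x + b) | x b. x \<in> X \<and> b \<in> B}"
      unfolding linear_add[OF assms(1)] linear_scale[OF assms(1)] by blast
    then show ?thesis
      unfolding quotient_space_def vspace.simps by blast
  qed
  have "bij_betw (vimage F) (vs_carrier (quotient_space (F ` Z) (F ` B)))
      (vs_carrier (quotient_space Z B))"
    unfolding carrier
    by (rule bij_betw_byWitness[where f' = "(`) F"]) (auto simp: vimage_image)
  then show ?thesis
    unfolding vs_iso_def
    by (intro exI[of _ "vimage F"]) (auto simp: carrier add scale vimage_image)
qed

lemma cohomology_iso:
  assumes "linear F" and "inj F"
    and cochains: "\<And>k. C' k = F ` C k"
    and chain_map: "\<And>k c. c \<in> C k \<Longrightarrow> d' k (F c) = F (d k c)"
  shows "cohomology C' d' k \<cong>\<^sub>v cohomology C d k"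
proof -
  have "F x = 0 \<longleftrightarrow> x = 0" for x
    using inj_eq[OF assms(2), of x 0] linear_0[OF assms(1)] by simp
  then have "d' k (F c) = 0 \<longleftrightarrow> d k c = 0" if "c \<in> C k" for c
    using chain_map[OF that] by metis
  then have cocycles: "{c \<in> C' k. d' k c = 0} = F ` {c \<in> C k. d k c = 0}"
    unfolding cochains by blast
  have coboundaries: "(case k of 0 \<Rightarrow> {0} | Suc m \<Rightarrow> d' m ` C' m)
      = F ` (case k of 0 \<Rightarrow> {0} | Suc m \<Rightarrow> d m ` C m)"
  proof (cases k)
    case 0
    then show ?thesis by (simp add: linear_0[OF assms(1)])
  next
    case (Suc m)
    have "d' m ` F ` C m = F ` d m ` C m"
      unfolding image_image by (intro image_cong refl chain_map)
    with Suc show ?thesis by (simp add: cochains)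
  qed
  show ?thesis
    unfolding cohomology_def cocycles coboundaries
    by (rule quotient_space_image_iso[OF assms(1,2)])
qed

lemma linear_comp_left:
  assumes "linear \<rho>"
  shows "linear (\<lambda>c. \<rho> \<circ> c)"
  by (auto simp: linear_iff fun_eq_iff linear_add[OF assms] linear_scale[OF assms])

lemma inj_comp_left:
  assumes "inj \<rho>"
  shows "inj (\<lambda>c. \<rho> \<circ> c)"
  using assms by (auto simp: inj_def fun_eq_iff)

lemma linear_of_linear_comp:
  assumes "linear \<rho>" and "inj \<rho>" and "linear (\<lambda>x. \<rho> (f x))"
  shows "linear f"
proof (rule linearI)
  fix x y t
  have "\<rho> (f (x + y)) = \<rho> (f x + f y)"
    using linear_add[OF assms(3)] by (simp add: linear_add[OF assms(1)])
  then show "f (x + y) = f x + f y" by (rule injD[OF assms(2)])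
  have "\<rho> (f (t *\<^sub>R x)) = \<rho> (t *\<^sub>R f x)"
    using linear_scale[OF assms(3)] by (simp add: linear_scale[OF assms(1)])
  then show "f (t *\<^sub>R x) = t *\<^sub>R f x" by (rule injD[OF assms(2)])
qed

text \<open>A cochain with values in \<open>range \<rho>\<close> factors through \<open>\<rho>\<close>, and the factor is again
  multilinear because \<open>\<rho>\<close> reflects linearity.\<close>

lemma image_comp_cochains:
  fixes \<rho> :: "'v::real_vector \<Rightarrow> 'w::real_vector"
  assumes "linear \<rho>" and "inj \<rho>"
  shows "(\<lambda>c. \<rho> \<circ> c) ` cochains UNIV k
      = (cochains (range \<rho>) k :: ('g::real_vector list \<Rightarrow> 'w) set)"
proof (intro equalityI subsetI)
  fix c :: "'g list \<Rightarrow> 'w"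
  assume "c \<in> (\<lambda>c. \<rho> \<circ> c) ` cochains UNIV k"
  then show "c \<in> cochains (range \<rho>) k"
    using linear_compose[OF _ assms(1)]
    by (auto simp: cochains_def linear_0[OF assms(1)] o_def)
next
  fix c :: "'g list \<Rightarrow> 'w"
  assume c: "c \<in> cochains (range \<rho>) k"
  define c' where "c' = inv \<rho> \<circ> c"
  \<comment> \<open>On lists of the wrong length the value of \<open>c\<close> is \<open>0 = \<rho> 0\<close>, so it lies in the range too.\<close>
  have "c xs \<in> range \<rho>" for xs
    using c linear_0[OF assms(1)] by (cases "length xs = k") (auto simp: cochains_def image_iff)
  then have \<rho>_c': "\<rho> (c' xs) = c xs" for xs
    by (simp add: c'_def f_inv_into_f)
  have "c' xs = 0" if "length xs \<noteq> k" for xs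
    using that c \<rho>_c'[of xs] linear_0[OF assms(1)] injD[OF assms(2), of "c' xs" 0]
    by (simp add: cochains_def)
  moreover have "linear (\<lambda>x. c' (xs[i := x]))" if "length xs = k" "i < k" for xs i
    using that c
    by (intro linear_of_linear_comp[OF assms]) (simp add: \<rho>_c' cochains_def)
  ultimately have "c' \<in> cochains UNIV k"
    by (simp add: cochains_def)
  moreover have "c = \<rho> \<circ> c'"
    by (simp add: fun_eq_iff \<rho>_c')
  ultimately show "c \<in> (\<lambda>c. \<rho> \<circ> c) ` cochains UNIV k"
    by blast
qed

text \<open>The bracket terms of the differential only evaluate the cochain, so they are compatible
  with postcomposition by any linear map; the other terms need that it is equivariant.\<close>

lemma comp_diff:
  assumes "linear \<rho>"
    and "\<And>x v. \<rho> (L x v) = L' x (\<rho> v)" and "\<And>x v. \<rho> (R x v) = R' x (\<rho> v)"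
  shows "diff br L' R' k (\<rho> \<circ> c) = \<rho> \<circ> diff br L R k c"
  by (auto simp: diff_def fun_eq_iff linear_0[OF assms(1)] linear_add[OF assms(1)]
      linear_diff[OF assms(1)] linear_neg[OF assms(1)] linear_sum[OF assms(1)]
      linear_scale[OF assms(1)] assms(2,3))

theorem theorem4p3:
  fixes br :: "'g::real_vector \<Rightarrow> 'g \<Rightarrow> 'g"
  assumes "leibniz_algebra br"
  shows "\<forall>k. naive_cohomology br (naive_ad br) k
             \<cong>\<^sub>v leibniz_cohomology br (ad_L br) (ad_R br) k"
proof
  fix k
  interpret leibniz_algebra br by fact
  let ?\<rho> = "naive_ad br"
  have lin: "linear ?\<rho>" and hom: "?\<rho> (br x y) = ol_br (?\<rho> x) (?\<rho> y)" for x y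
    using naive_rep_ad by (auto simp: naive_rep_def)
  have inj: "inj ?\<rho>"
    by (simp add: inj_def naive_ad_def)
  have chain_map: "naive_diff br ?\<rho> m (?\<rho> \<circ> c) = ?\<rho> \<circ> leibniz_diff br (ad_L br) (ad_R br) m c"
    for m c
    unfolding naive_diff_def leibniz_diff_def
    by (rule comp_diff[OF lin]) (simp_all add: hom)
  show "naive_cohomology br ?\<rho> k \<cong>\<^sub>v leibniz_cohomology br (ad_L br) (ad_R br) k"
    unfolding naive_cohomology_def leibniz_cohomology_def
    by (rule cohomology_iso[OF linear_comp_left[OF lin] inj_comp_left[OF inj]])
      (simp_all add: image_comp_cochains[OF lin inj] chain_map)
qed

end
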